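(* For every integer $n\ge 5$, $m(K(n,2))=3$.
   Context: The Kneser graph $K(n,2)$ has as vertices all $2$-element subsets of $[n]=\{1,\dots,n\}$, two vertices being adjacent iff they are disjoint. For a graph $G$ and $u,v\in V(G)$, the monophonic interval $J_G(u,v)$ is the set of all vertices lying on some induced $u,v$-path in $G$. A set $S\subseteq V(G)$ is a monophonic set of $G$ if for every $w\in V(G)$ there exist $x,y\in S$ with $w\in J_G(x,y)$. The monophonic number $m(G)$ is the minimum cardinality of a monophonic set of $G$. *)

theory Defs
  imports "Graph_Theory.Graph_Theory"
begin

text \<open>
  Following the Graph_Theory library, an undirected graph is a symmetric loop-free digraph:
  every edge is represented by its two opposite arcs.
\<close>

definition kneser :: "nat \<Rightarrow> nat \<Rightarrow> nat set pair_pre_digraph" where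
  "kneser n k = \<lparr>
     pverts = {A. A \<subseteq> {1..n} \<and> card A = k},
     parcs = {(A, B). A \<subseteq> {1..n} \<and> card A = k \<and> B \<subseteq> {1..n} \<and> card B = k \<and> A \<inter> B = {}} \<rparr>"

lemma pair_graph_kneser:
  assumes "k > 0"
  shows "pair_graph (kneser n k)"
proof
  fix e assume e: "e \<in> parcs (kneser n k)"
  then show "fst e \<in> pverts (kneser n k)" "snd e \<in> pverts (kneser n k)"
    by (simp_all add: kneser_def split_beta)
  from e have "card (fst e) = k" "fst e \<inter> snd e = {}"
    by (simp_all add: kneser_def split_beta)
  with assms show "fst e \<noteq> snd e"
    by (metis Int_absorb card.empty less_irrefl)
next
  have "pverts (kneser n k) \<subseteq> Pow {1..n}"
    by (auto simp add: kneser_def)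
  then show "finite (pverts (kneser n k))"
    by (rule finite_subset) simp
next
  have "parcs (kneser n k) \<subseteq> Pow {1..n} \<times> Pow {1..n}"
    by (auto simp add: kneser_def)
  then show "finite (parcs (kneser n k))"
    by (rule finite_subset) simp
next
  show "symmetric (with_proj (kneser n k))"
    by (simp add: symmetric_def sym_def kneser_def Int_commute)
qed

text \<open>
  The arcs joining two vertices of the path, i.e. the arcs of the subgraph induced by its vertices,
  are exactly the edges of the path taken in both directions.  As in the library, a list \<open>[u]\<close> with
  \<open>u\<close> a vertex is a (trivial) path from \<open>u\<close> to \<open>u\<close>; it is induced in a loop-free graph.
\<close>

definition induced_path :: "('a, 'b) pre_digraph \<Rightarrow> 'a \<Rightarrow> 'a list \<Rightarrow> 'a \<Rightarrow> bool" where
  "induced_path G u p v \<longleftrightarrow>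
     vpath p G \<and> hd p = u \<and> last p = v \<and>
     arcs_ends G \<inter> (set p \<times> set p) = set (vwalk_arcs p) \<union> (set (vwalk_arcs p))\<inverse>"

definition monophonic_interval :: "('a, 'b) pre_digraph \<Rightarrow> 'a \<Rightarrow> 'a \<Rightarrow> 'a set" where
  "monophonic_interval G u v = {w. \<exists>p. induced_path G u p v \<and> w \<in> set p}"

definition monophonic_set :: "('a, 'b) pre_digraph \<Rightarrow> 'a set \<Rightarrow> bool" where
  "monophonic_set G S \<longleftrightarrow>
     S \<subseteq> verts G \<and> (\<forall>w \<in> verts G. \<exists>x \<in> S. \<exists>y \<in> S. w \<in> monophonic_interval G x y)"

text \<open>
  Finiteness is automatic for a finite graph; without it, infinite sets would count as having
  cardinality \<open>0\<close>.
\<close>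

definition monophonic_number :: "('a, 'b) pre_digraph \<Rightarrow> nat" where
  "monophonic_number G = (LEAST m. \<exists>S. monophonic_set G S \<and> finite S \<and> card S = m)"

end

theory Submission
  imports Defs
begin

text \<open>
  Two adjacent vertices span only the interval consisting of themselves.  If \<open>{a,b}\<close> and \<open>{a,c}\<close> are
  distinct non-adjacent vertices, then no induced path between them passes through \<open>{b,c}\<close>: its
  neighbours on such a path would have to be \<open>{a,x}\<close> and \<open>{a,y}\<close>, the second and the penultimate
  vertex would be \<open>{c,z}\<close> and \<open>{b,z}\<close>, and the absence of chords forces \<open>x = z = y\<close>.  So two vertices
  never suffice.  Conversely \<open>{1,2}\<close>, \<open>{1,3}\<close>, \<open>{2,3}\<close> form a monophonic set: a vertex disjoint from
  \<open>{1,2,3}\<close> is a common neighbour of two of them, and \<open>{1,x}\<close> lies on the induced path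
  \<open>{1,2}, {3,y}, {1,x}, {2,3}\<close>.
\<close>

section \<open>Induced paths described by positions\<close>

lemma set_vwalk_arcs_conv_nth:
  "set (vwalk_arcs p) = {(p ! i, p ! Suc i) | i. Suc i < length p}"
proof (induction p rule: vwalk_arcs.induct)
  case (3 x y xs)
  show ?case
  proof (intro set_eqI iffI)
    fix e assume "e \<in> set (vwalk_arcs (x # y # xs))"
    then consider "e = (x, y)"
      | i where "Suc i < length (y # xs)" "e = ((y # xs) ! i, (y # xs) ! Suc i)"
      using 3 by auto
    then show "e \<in> {((x # y # xs) ! i, (x # y # xs) ! Suc i) | i. Suc i < length (x # y # xs)}"
    proof cases
      case 1
      then show ?thesis by (intro CollectI exI[of _ 0]) simp
    next
      case (2 i)
      then show ?thesis by (intro CollectI exI[of _ "Suc i"]) simp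
    qed
  next
    fix e assume "e \<in> {((x # y # xs) ! i, (x # y # xs) ! Suc i) | i. Suc i < length (x # y # xs)}"
    then obtain i where "Suc i < length (x # y # xs)" "e = ((x # y # xs) ! i, (x # y # xs) ! Suc i)"
      by blast
    then show "e \<in> set (vwalk_arcs (x # y # xs))"
      using 3 by (cases i) auto
  qed
qed auto

text \<open>Since the vertices of \<open>p\<close> are distinct, a vertex determines its position,
  and chordlessness becomes arithmetic on indices. The later arguments about arbitrary induced paths
  use it in this form.\<close>

lemma induced_path_arcs_nth_iff:
  assumes "induced_path G u p v" "i < length p" "j < length p"
  shows "(p ! i, p ! j) \<in> arcs_ends G \<longleftrightarrow> j = Suc i \<or> i = Suc j"
proof -
  have "distinct p"
    using assms(1) by (auto simp: induced_path_def vpath_def)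
  have "(p ! i, p ! j) \<in> arcs_ends G \<longleftrightarrow>
      (p ! i, p ! j) \<in> set (vwalk_arcs p) \<union> (set (vwalk_arcs p))\<inverse>"
    using assms unfolding induced_path_def by (metis IntD1 IntI SigmaI nth_mem)
  also have "\<dots> \<longleftrightarrow> j = Suc i \<or> i = Suc j"
    using \<open>distinct p\<close> assms(2,3)
    by (auto simp: set_vwalk_arcs_conv_nth nth_eq_iff_index_eq)
  finally show ?thesis .
qed

lemma induced_path_nth:
  assumes "induced_path G u p v"
  shows "p \<noteq> []" "p ! 0 = u" "p ! (length p - 1) = v" "distinct p"
  using assms by (auto simp: induced_path_def vpath_def vwalk_def hd_conv_nth last_conv_nth)

text \<open>Distinctness puts equal ends at the same position, so the path has one vertex.
  Loop-freeness makes \<open>[u]\<close> induced, because \<open>vwalk_arcs [u]\<close> is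
  empty.\<close>

lemma monophonic_interval_refl:
  assumes "loopfree_digraph G" "u \<in> verts G"
  shows "monophonic_interval G u u = {u}"
proof
  show "monophonic_interval G u u \<subseteq> {u}"
  proof
    fix w assume "w \<in> monophonic_interval G u u"
    then obtain p where p: "induced_path G u p u" "w \<in> set p"
      by (auto simp: monophonic_interval_def)
    note nth = induced_path_nth[OF p(1)]
    then have "length p - 1 = 0"
      using nth_eq_iff_index_eq[of p "length p - 1" 0] by auto
    with nth(1) have "length p = 1"
      by (cases p) auto
    then show "w \<in> {u}"
      using p(2) nth(2) by (cases p) auto
  qed
  have "(u, u) \<notin> arcs_ends G"
    using loopfree_digraph.no_loops[OF assms(1)] by (auto simp: arcs_ends_conv)
  then have "induced_path G u [u] u"
    using assms(2) by (auto simp: induced_path_def vpath_def vwalk_def)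
  then show "{u} \<subseteq> monophonic_interval G u u"
    by (auto simp: monophonic_interval_def)
qed

text \<open>An edge between the ends would be a chord unless the first and last positions are
  consecutive, so the path has just two vertices.\<close>

lemma monophonic_interval_adjacent:
  assumes "(u, v) \<in> arcs_ends G"
  shows "monophonic_interval G u v \<subseteq> {u, v}"
proof
  fix w assume "w \<in> monophonic_interval G u v"
  then obtain p where p: "induced_path G u p v" "w \<in> set p"
    by (auto simp: monophonic_interval_def)
  note nth = induced_path_nth[OF p(1)]
  have "length p - 1 = 1"
    using induced_path_arcs_nth_iff[OF p(1), of 0 "length p - 1"] assms nth by auto
  moreover obtain k where "k < length p" "w = p ! k"
    using p(2) by (auto simp: in_set_conv_nth)
  ultimately have "w = p ! k" "k = 0 \<or> k = length p - 1"
    by auto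
  then show "w \<in> {u, v}"
    using nth by auto
qed

section \<open>Induced paths with three or four vertices\<close>

context pair_graph
begin

lemma pair_arcs_sym: "(u, v) \<in> parcs G \<Longrightarrow> (v, u) \<in> parcs G"
  using arcs_symmetric by blast

lemma pair_no_loop: "(u, u) \<notin> parcs G"
  using no_loops by fastforce

lemma common_neighbour_in_monophonic_interval:
  assumes "(u, v) \<in> parcs G" "(v, w) \<in> parcs G" "(u, w) \<notin> parcs G" "u \<noteq> w"
  shows "v \<in> monophonic_interval (with_proj G) u w"
proof -
  have "(w, u) \<notin> parcs G"
    using assms(3) pair_arcs_sym by blast
  then have "induced_path (with_proj G) u [u, v, w] w"
    using assms pair_no_loop
    by (auto simp: induced_path_def vpath_def vwalk_def
        intro: pair_arcs_sym dest: in_arcsD1 in_arcsD2)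
  then show ?thesis
    by (auto simp: monophonic_interval_def)
qed

lemma third_vertex_in_monophonic_interval:
  assumes "(u, v) \<in> parcs G" "(v, w) \<in> parcs G" "(w, z) \<in> parcs G"
    and "(u, w) \<notin> parcs G" "(u, z) \<notin> parcs G" "(v, z) \<notin> parcs G"
    and "u \<noteq> w" "u \<noteq> z" "v \<noteq> z"
  shows "w \<in> monophonic_interval (with_proj G) u z"
proof -
  have "(w, u) \<notin> parcs G" "(z, u) \<notin> parcs G" "(z, v) \<notin> parcs G"
    using assms(4-6) pair_arcs_sym by blast+
  then have "induced_path (with_proj G) u [u, v, w, z] z"
    using assms pair_no_loop
    by (auto simp: induced_path_def vpath_def vwalk_def
        intro: pair_arcs_sym dest: in_arcsD1 in_arcsD2)
  then show ?thesis
    by (auto simp: monophonic_interval_def)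
qed

end

section \<open>Kneser graphs and the lower bound\<close>

lemma in_pverts_kneser_iff: "A \<in> pverts (kneser n k) \<longleftrightarrow> A \<subseteq> {1..n} \<and> card A = k"
  by (simp add: kneser_def)

lemma in_parcs_kneser_iff:
  "(A, B) \<in> parcs (kneser n k) \<longleftrightarrow>
     A \<in> pverts (kneser n k) \<and> B \<in> pverts (kneser n k) \<and> A \<inter> B = {}"
  by (auto simp: kneser_def)

interpretation kneser2: pair_graph "kneser n 2" for n
  by (rule pair_graph_kneser) simp

lemma card_2_memberE:
  assumes "card A = 2" "a \<in> A"
  obtains x where "A = {a, x}" "a \<noteq> x"
  using assms by (auto simp: card_2_iff)

lemma third_pair_notin_monophonic_interval:
  assumes abc: "a \<noteq> b" "a \<noteq> c" "b \<noteq> c"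
  shows "{b, c} \<notin> monophonic_interval (with_proj (kneser n 2)) {a, b} {a, c}"
proof
  assume "{b, c} \<in> monophonic_interval (with_proj (kneser n 2)) {a, b} {a, c}"
  then obtain p where p: "induced_path (with_proj (kneser n 2)) {a, b} p {a, c}"
      and "{b, c} \<in> set p"
    by (auto simp: monophonic_interval_def)
  then obtain k where k: "k < length p" "p ! k = {b, c}"
    by (auto simp: in_set_conv_nth)
  define m where "m = length p - 1"
  have len: "length p = Suc m"
    using k by (simp add: m_def)
  have p0: "p ! 0 = {a, b}" and pm: "p ! m = {a, c}" and "distinct p"
    using induced_path_nth[OF p] by (simp_all add: m_def)
  have vert: "p ! i \<in> pverts (kneser n 2)" if "i \<le> m" for i
    using p that nth_mem[of i p] by (auto simp: induced_path_def vpath_def vwalk_def len)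
  then have card: "card (p ! i) = 2" if "i \<le> m" for i
    using that by (simp add: in_pverts_kneser_iff)
  have disj: "p ! i \<inter> p ! j = {} \<longleftrightarrow> j = Suc i \<or> i = Suc j" if "i \<le> m" "j \<le> m" for i j
    using induced_path_arcs_nth_iff[OF p, of i j] that vert
    by (simp add: in_parcs_kneser_iff len)
  have "k \<noteq> 0" "k \<noteq> m" "k \<le> m"
    using k p0 pm abc by (auto simp: len doubleton_eq_iff)
  then have k1: "0 < k" "k < m" "k - 1 \<le> m" by auto

  \<comment> \<open>This neighbour of \<open>{b, c}\<close> avoids \<open>b\<close> and
    \<open>c\<close>. If it also missed \<open>a\<close>, it would be adjacent to the end
    \<open>{a, c}\<close>, a chord because \<open>k < m\<close>. The successor of
    \<open>{b, c}\<close> is treated in the same way with the end \<open>{a, b}\<close>.\<close>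
  have "a \<in> p ! (k - 1)"
  proof (rule ccontr)
    assume "a \<notin> p ! (k - 1)"
    moreover have "p ! (k - 1) \<inter> {b, c} = {}"
      using disj[of "k - 1" k] k1 k by auto
    ultimately have "p ! (k - 1) \<inter> p ! m = {}"
      using pm by auto
    then show False
      using disj[of "k - 1" m] k1 by linarith
  qed
  then obtain x where x: "p ! (k - 1) = {a, x}" "a \<noteq> x"
    using card[of "k - 1"] k1 by (auto elim: card_2_memberE)
  have "a \<in> p ! Suc k"
  proof (rule ccontr)
    assume "a \<notin> p ! Suc k"
    moreover have "p ! Suc k \<inter> {b, c} = {}"
      using disj[of "Suc k" k] k1 k by auto
    ultimately have "p ! Suc k \<inter> p ! 0 = {}"
      using p0 by auto
    then show False
      using disj[of "Suc k" 0] k1 by auto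
  qed
  then obtain y where y: "p ! Suc k = {a, y}" "a \<noteq> y"
    using card[of "Suc k"] k1 by (auto elim: card_2_memberE)
  have "x \<noteq> y"
    using x y \<open>distinct p\<close> k1 nth_eq_iff_index_eq[of p "k - 1" "Suc k"] by (auto simp: len)
  have xbc: "x \<noteq> b" "x \<noteq> c"
    using disj[of "k - 1" k] k1 k x by auto
  have ybc: "y \<noteq> b" "y \<noteq> c"
    using disj[of "Suc k" k] k1 k y by auto

  \<comment> \<open>Consecutive vertices are disjoint, but \<open>{a, b}\<close> meets both
    \<open>{b, c}\<close> and \<open>{a, x}\<close>; this keeps \<open>k\<close> away from the
    start. The end \<open>{a, c}\<close> is handled symmetrically.\<close>
  have "k \<noteq> 1"
    using disj[of 0 k] k k1 p0 by auto
  moreover have "k \<noteq> 2"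
    using disj[of 0 "k - 1"] k1 p0 x by auto
  ultimately have k3: "3 \<le> k"
    using k1 by auto
  have "m \<noteq> Suc k"
    using disj[of k m] k k1 pm by auto
  moreover have "m \<noteq> Suc (Suc k)"
    using disj[of "Suc k" m] k1 pm y by auto
  ultimately have m3: "k + 3 \<le> m"
    using k1 by auto

  \<comment> \<open>Positions \<open>1\<close> and \<open>k\<close> are not consecutive, so
    \<open>p ! 1\<close> meets \<open>{b, c}\<close>; it avoids \<open>b\<close>, hence contains
    \<open>c\<close>. By symmetry the penultimate vertex contains \<open>b\<close>.\<close>
  have p1: "p ! 1 \<inter> {a, b} = {}"
    using disj[of 1 0] p0 m3 by auto
  then have "c \<in> p ! 1"
    using disj[of 1 k] k k3 m3 by auto
  then obtain z where z: "p ! 1 = {c, z}" "c \<noteq> z"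
    using card[of 1] m3 by (auto elim: card_2_memberE)
  have q1: "p ! (m - 1) \<inter> {a, c} = {}"
    using disj[of "m - 1" m] pm m3 by auto
  then have "b \<in> p ! (m - 1)"
    using disj[of "m - 1" k] k k3 m3 by auto
  then obtain w where w: "p ! (m - 1) = {b, w}" "b \<noteq> w"
    using card[of "m - 1"] m3 by (auto elim: card_2_memberE)

  \<comment> \<open>By \<open>k3\<close> and \<open>m3\<close>, no two of the positions compared
    here are consecutive, so the corresponding pairs intersect. In each case the known inequalities
    leave only one possible common element.\<close>
  have "z = w"
    using disj[of 1 "m - 1"] k3 m3 z w p1 q1 abc by auto
  moreover have "z = y"
    using disj[of 1 "Suc k"] k3 m3 z y p1 ybc abc by auto
  moreover have "w = x"
    using disj[of "k - 1" "m - 1"] k1(3) k3 m3 w x q1 xbc abc by auto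
  ultimately show False
    using \<open>x \<noteq> y\<close> by simp
qed

text \<open>The case \<open>u = v\<close> is allowed, so that singletons are excluded as
  well.\<close>

lemma not_monophonic_set_kneser_pair:
  assumes "n \<ge> 4"
  shows "\<not> monophonic_set (with_proj (kneser n 2)) {u, v}"
proof
  let ?G = "with_proj (kneser n 2)"
  assume mono: "monophonic_set ?G {u, v}"
  then have uv: "u \<in> verts ?G" "v \<in> verts ?G"
    by (auto simp: monophonic_set_def)
  \<comment> \<open>The interval from a vertex to itself is a singleton, so only the two orders of
    distinct ends have to be examined.\<close>
  have cover: "w \<in> {u, v} \<or> w \<in> monophonic_interval ?G u v \<or> w \<in> monophonic_interval ?G v u"
    if "w \<in> verts ?G" for w
  proof -
    obtain x y where "x \<in> {u, v}" "y \<in> {u, v}" "w \<in> monophonic_interval ?G x y"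
      using mono \<open>w \<in> verts ?G\<close> unfolding monophonic_set_def by meson
    then show ?thesis
      using monophonic_interval_refl[OF kneser2.loopfree_digraph_axioms uv(1)]
        monophonic_interval_refl[OF kneser2.loopfree_digraph_axioms uv(2)]
      by (elim insertE emptyE) simp_all
  qed
  \<comment> \<open>Three explicit vertices, available since \<open>n \<ge> 4\<close>, guarantee one
    outside \<open>{u, v}\<close>.\<close>
  have "\<not> {{1, 2}, {1, 3}, {1, 4}} \<subseteq> {u, v}"
  proof
    assume "{{1, 2}, {1, 3}, {1, 4}} \<subseteq> {u, v}"
    then have "card {{1, 2}, {1, 3}, {1, 4 :: nat}} \<le> card {u, v}"
      by (intro card_mono) simp_all
    also have "\<dots> \<le> 2"
      by (simp add: card_insert_if)
    finally show False
      by (simp add: doubleton_eq_iff)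
  qed
  moreover have "{{1, 2}, {1, 3}, {1, 4}} \<subseteq> verts ?G"
    using assms by (simp add: in_pverts_kneser_iff)
  ultimately have outside: "\<exists>w \<in> verts ?G. w \<notin> {u, v}"
    by (meson subset_iff)
  show False
  proof (cases "u = v \<or> u \<inter> v = {}")
    case True
    have "monophonic_interval ?G u v \<union> monophonic_interval ?G v u \<subseteq> {u, v}"
    proof (cases "u = v")
      case True
      then show ?thesis
        using monophonic_interval_refl[OF kneser2.loopfree_digraph_axioms uv(1)] by simp
    next
      case False
      then have "(u, v) \<in> arcs_ends ?G" "(v, u) \<in> arcs_ends ?G"
        using True uv by (auto simp: in_parcs_kneser_iff)
      then show ?thesis
        using monophonic_interval_adjacent[of u v ?G] monophonic_interval_adjacent[of v u ?G]
        by auto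
    qed
    with outside cover show False by blast
  next
    case False
    then obtain a where a: "a \<in> u" "a \<in> v" by auto
    obtain b where b: "u = {a, b}" "a \<noteq> b"
      using a uv by (auto simp: in_pverts_kneser_iff elim: card_2_memberE)
    obtain c where c: "v = {a, c}" "a \<noteq> c"
      using a uv by (auto simp: in_pverts_kneser_iff elim: card_2_memberE)
    have "b \<noteq> c"
      using False b c by auto
    \<comment> \<open>This vertex differs from both ends; exchanging \<open>b\<close> and
      \<open>c\<close> covers paths from \<open>v\<close> to \<open>u\<close>.\<close>
    then have "{b, c} \<in> verts ?G"
      using b c uv by (auto simp: in_pverts_kneser_iff)
    then show False
      using cover[of "{b, c}"] b c \<open>b \<noteq> c\<close>
        third_pair_notin_monophonic_interval[of a b c n]
        third_pair_notin_monophonic_interval[of a c b n]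
      by (auto simp: doubleton_eq_iff insert_commute)
  qed
qed

section \<open>The upper bound\<close>

lemma pair_in_monophonic_interval:
  assumes "distinct [a, b, c, x, y]" "{a, b, c, x, y} \<subseteq> {1..n}"
  shows "{a, x} \<in> monophonic_interval (with_proj (kneser n 2)) {a, b} {b, c}"
  \<comment> \<open>The path is \<open>{a, b}, {c, y}, {a, x}, {b, c}\<close>. Its three
    non-consecutive pairs of vertices share \<open>a\<close>, \<open>b\<close> and \<open>c\<close>
    respectively, so it has no chord.\<close>
  using assms
  by (intro kneser2.third_vertex_in_monophonic_interval[of _ "{c, y}"])
    (auto simp: in_parcs_kneser_iff in_pverts_kneser_iff doubleton_eq_iff)

lemma monophonic_set_kneser_triangle:
  assumes "n \<ge> 5"
  shows "monophonic_set (with_proj (kneser n 2)) {{1, 2}, {1, 3}, {2, 3}}"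
proof -
  let ?G = "with_proj (kneser n 2)"
  let ?S = "{{1, 2}, {1, 3}, {2, 3 :: nat}}"
  have S: "?S \<subseteq> verts ?G"
    using assms by (auto simp: in_pverts_kneser_iff)
  have "\<exists>s \<in> ?S. \<exists>t \<in> ?S. w \<in> monophonic_interval ?G s t" if w: "w \<in> verts ?G" for w
  proof -
    have wn: "w \<subseteq> {1..n}" "card w = 2"
      using w by (auto simp: in_pverts_kneser_iff)
    \<comment> \<open>The cases are that \<open>w\<close> has two, none or exactly one of its
      elements in \<open>{1, 2, 3}\<close>.\<close>
    consider "w \<subseteq> {1, 2, 3}" | "w \<inter> {1, 2, 3} = {}"
      | a x where "w = {a, x}" "a \<in> {1, 2, 3}" "x \<notin> {1, 2, 3}" "x \<in> {1..n}"
    proof (cases "w \<subseteq> {1, 2, 3} \<or> w \<inter> {1, 2, 3} = {}")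
      case True
      then show ?thesis using that(1,2) by blast
    next
      case False
      then obtain a where a: "a \<in> w" "a \<in> {1, 2, 3}" by blast
      with wn(2) obtain x where "w = {a, x}"
        by (blast elim: card_2_memberE)
      then show ?thesis
        using False a wn(1) that(3)[of a x] by blast
    qed
    then show ?thesis
    proof cases
      case 1
      obtain a b where "w = {a, b}" "a \<noteq> b"
        using wn(2) by (auto simp: card_2_iff)
      with 1 have "w \<in> ?S"
        by (auto simp: insert_commute)
      then show ?thesis
        using monophonic_interval_refl[OF kneser2.loopfree_digraph_axioms w] by blast
    next
      case 2
      then have "w \<in> monophonic_interval ?G {1, 2} {1, 3}"
        using S w
        by (intro kneser2.common_neighbour_in_monophonic_interval)
          (auto simp: in_parcs_kneser_iff doubleton_eq_iff)
      then show ?thesis by blast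
    next
      case (3 a x)
      \<comment> \<open>The path needs a second point outside \<open>{1, 2, 3}\<close>, different
        from \<open>x\<close>; this is where \<open>n \<ge> 5\<close> enters.\<close>
      obtain y where y: "y \<in> {4, 5}" "y \<noteq> x"
        by (cases "x = 4") auto
      have "{a, b, c, x, y} \<subseteq> {1..n}" "distinct [a, b, c, x, y]"
        if "{a, b, c} = {1, 2, 3}" "distinct [a, b, c]" for b c
      proof -
        have "a \<in> {1, 2, 3}" "b \<in> {1, 2, 3}" "c \<in> {1, 2, 3}"
          using that(1) by blast+
        then show "{a, b, c, x, y} \<subseteq> {1..n}" "distinct [a, b, c, x, y]"
          using that(2) 3 y assms by auto
      qed
      then have in_interval: "w \<in> monophonic_interval ?G {a, b} {b, c}"
        if "{a, b, c} = {1, 2, 3}" "distinct [a, b, c]" for b c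
        using that 3(1) pair_in_monophonic_interval[of a b c x y n] by blast
      from 3(2) consider "a = 1" | "a = 2" | "a = 3" by blast
      then show ?thesis
      proof cases
        case 1
        then show ?thesis
          using in_interval[of 2 3] by auto
      next
        case 2
        then show ?thesis
          using in_interval[of 1 3] by (auto simp: insert_commute)
      next
        case 3
        then show ?thesis
          using in_interval[of 1 2] by (auto simp: insert_commute)
      qed
    qed
  qed
  with S show ?thesis
    by (simp only: monophonic_set_def) blast
qed

theorem theorem2p2:
  fixes n :: nat
  assumes "n \<ge> 5"
  shows "monophonic_number (with_proj (kneser n 2)) = 3"
  unfolding monophonic_number_def
proof (rule Least_equality)
  show "\<exists>S. monophonic_set (with_proj (kneser n 2)) S \<and> finite S \<and> card S = 3"
    using monophonic_set_kneser_triangle[OF assms]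
    by (intro exI[of _ "{{1, 2}, {1, 3}, {2, 3}}"]) (simp add: doubleton_eq_iff)
next
  fix m assume "\<exists>S. monophonic_set (with_proj (kneser n 2)) S \<and> finite S \<and> card S = m"
  then obtain S where S: "monophonic_set (with_proj (kneser n 2)) S" "finite S" "card S = m"
    by blast
  have "{1, 2} \<in> verts (with_proj (kneser n 2))"
    using assms by (auto simp: in_pverts_kneser_iff)
  then have "S \<noteq> {}"
    using S(1) by (auto simp: monophonic_set_def)
  show "3 \<le> m"
  proof (rule ccontr)
    assume "\<not> 3 \<le> m"
    moreover have "m \<noteq> 0"
      using S \<open>S \<noteq> {}\<close> by auto
    ultimately have "card S = 1 \<or> card S = 2"
      using S(3) by auto
    \<comment> \<open>A singleton is written with \<open>u = v\<close>.\<close>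
    then obtain u v where "S = {u, v}"
      by (auto simp: card_1_singleton_iff card_2_iff)
    then show False
      using S(1) not_monophonic_set_kneser_pair[of n u v] assms by simp
  qed
qed

end
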